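(* For every uncountable $X\subset\omega_1$, the subgroup $\mathrm{grp}(\mathcal{L}_X)$ of $\mathbb{T}^X$ contains a (homeomorphic) copy of $A(\omega_1)$.
   Context: $A(\omega_1)$ is the one-point compactification of the discrete space of size $\omega_1$. For a subset $A$ of a group, $\mathrm{grp}(A)$ is the smallest subgroup containing $A$. The function $\mathrm{osc}$ (Moore). Let $(e_\alpha)_{\alpha<\omega_1}$ be a coherent sequence: $e_\alpha:\alpha\to\omega$ is finite-to-one, and for all $\alpha<\beta$ the set $\{\xi<\alpha: e_\alpha(\xi)\ne e_\beta(\xi)\}$ is finite. Let $L:\{(\alpha,\beta)\in\omega_1^2:\alpha\le\beta\}\to[\omega_1]^{<\omega}$ be a function such that: (i) $L(\alpha,\beta)\subset\alpha$, and $L(\alpha,\beta)=\emptyset$ iff $\alpha=0$ or $\alpha=\beta$; (ii) if $\alpha\le\beta\le\gamma$ and $L(\beta,\gamma)<L(\alpha,\beta)$ (every element of the first set is less than every element of the second), then $L(\alpha,\gamma)=L(\beta,\gamma)\cup L(\alpha,\beta)$; (iii) if $\beta$ is a limit ordinal, then $\lim_{\alpha\to\beta}\min L(\alpha,\beta)=\beta$. For $\alpha<\beta<\omega_1$, $\mathrm{osc}(\alpha,\beta)\in\omega$ is the cardinality of the set of all $\xi\in L(\alpha,\beta)\setminus\{\min L(\alpha,\beta)\}$ such that $e_\alpha(\xi^-)=e_\beta(\xi^-)$ and $e_\alpha(\xi)>e_\beta(\xi)$, where $\xi^-$ is the greatest element of $L(\alpha,\beta)$ smaller than $\xi$. Moore's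 choice of these objects, which is fixed here, has the following property (a known theorem of Moore, which may be assumed): for all uncountable families $\mathcal{A}\subset[\omega_1]^k$ and $\mathcal{B}\subset[\omega_1]^l$ of pairwise disjoint sets and every $n\in\omega$ there exist $a\in\mathcal{A}$ and $b_m\in\mathcal{B}$ ($m<n$) such that for all $i<k$, $j<l$, $m<n$: $a<b_m$ (i.e. $\max a<\min b_m$) and $\mathrm{osc}(a(i),b_m(j))=\mathrm{osc}(a(i),b_0(j))+m$. Here $a(i)$ denotes the $i$-th element of $a$ in increasing order (starting from $i=0$). Let $\mathbb{T}=\{z\in\mathbb{C}:|z|=1\}$ (a multiplicative group), and fix a sequence $(z_\alpha)_{\alpha<\omega_1}$ of rationally independent points of $\mathbb{T}$ (no nontrivial finite product of integer powers of distinct $z_\alpha$'s equals $1$). For $\alpha<\beta<\omega_1$ put $o(\alpha,\beta)=z_\alpha^{\mathrm{osc}(\alpha,\beta)+1}$. Define $w_\beta\in\mathbb{T}^{\omega_1}$ by $w_\beta(\alpha)=o(\alpha,\beta)$ if $\alpha<\beta$ and $w_\beta(\alpha)=1$ otherwise. For $X\subset\omega_1$ let $\mathcal{L}_X=\{w_\beta|X:\beta\in X\}\subset\mathbb{T}^X$, where $\mathbb{T}^X$ has the product topology and coordinatewise multiplication.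
   Formalization: Condition (ii) on L is required only for α > 0: at α = 0 it would contradict (i), since for 0 < β < γ the relation L(β,γ) < L(0,β) = ∅ holds vacuously and would force L(β,γ) = L(0,γ) = ∅. *)

theory Defs
  imports "HOL-Analysis.Analysis" "HOL-Algebra.Product_Groups"
begin

(* The ordinal omega_1 is represented by a type 'a of class wellorder that is uncountable and
   all of whose proper initial segments are countable; this determines the order up to
   isomorphism.  The ordinal alpha, as the set of its predecessors, is {..<alpha}; in
   particular alpha = 0 is expressed by {..<alpha} = {}. *)
definition omega1_order :: "'a::wellorder itself \<Rightarrow> bool" where
  "omega1_order _ \<longleftrightarrow> uncountable (UNIV :: 'a set) \<and> (\<forall>\<alpha>::'a. countable {..<\<alpha>})"

definition limit_ordinal :: "'a::wellorder \<Rightarrow> bool" where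
  "limit_ordinal \<beta> \<longleftrightarrow> {..<\<beta>} \<noteq> {} \<and> (\<forall>\<gamma><\<beta>. \<exists>\<delta><\<beta>. \<gamma> < \<delta>)"

(* Only the values e alpha xi with xi < alpha are relevant. *)
definition coherent_sequence :: "('a::wellorder \<Rightarrow> 'a \<Rightarrow> nat) \<Rightarrow> bool" where
  "coherent_sequence e \<longleftrightarrow>
     (\<forall>\<alpha> n. finite {\<xi>. \<xi> < \<alpha> \<and> e \<alpha> \<xi> = n}) \<and>
     (\<forall>\<alpha> \<beta>. \<alpha> < \<beta> \<longrightarrow> finite {\<xi>. \<xi> < \<alpha> \<and> e \<alpha> \<xi> \<noteq> e \<beta> \<xi>})"

(* Only the values L alpha beta with alpha \<le> beta are relevant.  In the third clause alpha must
   be nonzero: since L 0 beta = {}, for alpha = 0 the premise would hold vacuously and the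
   conclusion would give L beta gamma = {} for 0 < beta < gamma, against the second clause.
   The last clause says that Min (L alpha beta) tends to beta as alpha tends to beta. *)
definition lower_trace :: "('a::wellorder \<Rightarrow> 'a \<Rightarrow> 'a set) \<Rightarrow> bool" where
  "lower_trace L \<longleftrightarrow>
     (\<forall>\<alpha> \<beta>. \<alpha> \<le> \<beta> \<longrightarrow> finite (L \<alpha> \<beta>) \<and> L \<alpha> \<beta> \<subseteq> {..<\<alpha>}) \<and>
     (\<forall>\<alpha> \<beta>. \<alpha> \<le> \<beta> \<longrightarrow> (L \<alpha> \<beta> = {} \<longleftrightarrow> {..<\<alpha>} = {} \<or> \<alpha> = \<beta>)) \<and>
     (\<forall>\<alpha> \<beta> \<gamma>. {..<\<alpha>} \<noteq> {} \<and> \<alpha> \<le> \<beta> \<and> \<beta> \<le> \<gamma> \<and> (\<forall>\<xi>\<in>L \<beta> \<gamma>. \<forall>\<eta>\<in>L \<alpha> \<beta>. \<xi> < \<eta>)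
        \<longrightarrow> L \<alpha> \<gamma> = L \<beta> \<gamma> \<union> L \<alpha> \<beta>) \<and>
     (\<forall>\<beta>. limit_ordinal \<beta> \<longrightarrow>
        (\<forall>\<gamma><\<beta>. \<exists>\<delta><\<beta>. \<forall>\<alpha>. \<delta> < \<alpha> \<and> \<alpha> < \<beta> \<longrightarrow> \<gamma> < Min (L \<alpha> \<beta>)))"

definition osc ::
  "('a::wellorder \<Rightarrow> 'a \<Rightarrow> nat) \<Rightarrow> ('a \<Rightarrow> 'a \<Rightarrow> 'a set) \<Rightarrow> 'a \<Rightarrow> 'a \<Rightarrow> nat" where
  "osc e L \<alpha> \<beta> =
     card {\<xi> \<in> L \<alpha> \<beta> - {Min (L \<alpha> \<beta>)}.
             let p = Max {\<eta> \<in> L \<alpha> \<beta>. \<eta> < \<xi>} in e \<alpha> p = e \<beta> p \<and> e \<alpha> \<xi> > e \<beta> \<xi>}"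

(* a(i), the i-th element of the finite set a, is sorted_list_of_set a ! i. *)
definition moore_property :: "('a::wellorder \<Rightarrow> 'a \<Rightarrow> nat) \<Rightarrow> bool" where
  "moore_property f \<longleftrightarrow>
     (\<forall>k l n. \<forall>\<A> \<B>.
        uncountable \<A> \<and> (\<forall>a\<in>\<A>. finite a \<and> card a = k) \<and> pairwise disjnt \<A> \<and>
        uncountable \<B> \<and> (\<forall>b\<in>\<B>. finite b \<and> card b = l) \<and> pairwise disjnt \<B> \<longrightarrow>
        (\<exists>a\<in>\<A>. \<exists>b::nat \<Rightarrow> 'a set. (\<forall>m<n. b m \<in> \<B>) \<and>
           (\<forall>i<k. \<forall>j<l. \<forall>m<n.
              Max a < Min (b m) \<and>
              f (sorted_list_of_set a ! i) (sorted_list_of_set (b m) ! j) =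
                f (sorted_list_of_set a ! i) (sorted_list_of_set (b 0) ! j) + m)))"

definition rationally_independent :: "('i \<Rightarrow> complex) \<Rightarrow> bool" where
  "rationally_independent z \<longleftrightarrow>
     (\<forall>F (n :: 'i \<Rightarrow> int). finite F \<and> (\<Prod>\<alpha>\<in>F. z \<alpha> powi n \<alpha>) = 1 \<longrightarrow> (\<forall>\<alpha>\<in>F. n \<alpha> = 0))"

definition circle_group :: "complex monoid" where
  "circle_group = \<lparr>carrier = sphere 0 1, monoid.mult = (*), one = 1\<rparr>"

lemma group_circle_group: "group circle_group"
proof (rule groupI)
  fix x assume "x \<in> carrier circle_group"
  then show "\<exists>y\<in>carrier circle_group. y \<otimes>\<^bsub>circle_group\<^esub> x = \<one>\<^bsub>circle_group\<^esub>"
    by (intro bexI[of _ "inverse x"]) (auto simp: circle_group_def norm_inverse intro!: left_inverse)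
qed (auto simp: circle_group_def norm_mult)

definition torus_group :: "'i set \<Rightarrow> ('i \<Rightarrow> complex) monoid" where
  "torus_group X = product_group X (\<lambda>_. circle_group)"

definition torus_topology :: "'i set \<Rightarrow> ('i \<Rightarrow> complex) topology" where
  "torus_topology X = product_topology (\<lambda>_. top_of_set (sphere 0 1)) X"

definition w_point ::
  "('a::wellorder \<Rightarrow> 'a \<Rightarrow> nat) \<Rightarrow> ('a \<Rightarrow> complex) \<Rightarrow> 'a \<Rightarrow> 'a \<Rightarrow> complex" where
  "w_point f z \<beta> \<alpha> = (if \<alpha> < \<beta> then z \<alpha> ^ (f \<alpha> \<beta> + 1) else 1)"

definition L_space ::
  "('a::wellorder \<Rightarrow> 'a \<Rightarrow> nat) \<Rightarrow> ('a \<Rightarrow> complex) \<Rightarrow> 'a set \<Rightarrow> ('a \<Rightarrow> complex) set" where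
  "L_space f z X = (\<lambda>\<beta>. restrict (w_point f z \<beta>) X) ` X"

end

theory Submission
  imports Defs
begin

text \<open>
  For an index \<open>\<xi>\<close> below \<open>\<omega>\<^sub>1\<close>, only countably many functions on \<open>\<xi>\<close> arise as the trace
  \<open>\<alpha> \<mapsto> osc \<alpha> \<beta>\<close> (\<open>\<alpha> < \<xi>\<close>) of some \<open>\<beta> \<ge> \<xi>\<close>: the number \<open>osc \<alpha> \<beta>\<close> is computed from
  \<open>e \<alpha>\<close>, the restriction of \<open>e \<beta>\<close> to \<open>\<xi>\<close> and the set \<open>L \<alpha> \<beta>\<close>. By coherence, the
  restriction of \<open>e \<beta>\<close> is a finite modification of \<open>e \<xi>\<close>, so it ranges over a countable set
  (\<open>countably_many_traces_coherent\<close>). The traces of \<open>L\<close> are counted by induction on \<open>\<xi>\<close>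
  (\<open>countably_many_traces_lower_trace\<close>): at a limit \<open>\<xi>\<close>, one has
  \<open>L \<alpha> \<beta> = L \<xi> \<beta> \<union> L \<alpha> \<xi>\<close> for all \<open>\<alpha>\<close> in a final segment of \<open>\<xi>\<close> which depends only on the
  finite set \<open>L \<xi> \<beta> \<subseteq> \<xi>\<close>, so the trace on \<open>\<xi>\<close> is determined by this finite set and a trace on a
  smaller ordinal.

  Hence, by the pigeonhole principle, every uncountable \<open>X\<close> contains for each \<open>\<xi>\<close> elements
  \<open>\<xi> \<le> \<beta> < \<gamma>\<close> with the same trace on \<open>\<xi>\<close>. The quotient of \<open>w\<^sub>\<beta>\<close> by \<open>w\<^sub>\<gamma>\<close> is then equal to
  \<open>1\<close> at all coordinates outside \<open>[\<xi>, \<gamma>)\<close>, but not at \<open>\<beta>\<close>, where it is the inverse of a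
  nontrivial power of \<open>z\<^sub>\<beta>\<close>. Choosing such pairs by transfinite recursion, each above all the
  previous ones, gives \<open>\<omega>\<^sub>1\<close> many elements of the group which differ from \<open>1\<close> on pairwise
  disjoint sets of coordinates (\<open>separated_pairs_with_equal_traces\<close>). A basic neighbourhood
  of \<open>1\<close> restricts only finitely many coordinates, so it contains all but finitely many of these
  elements, and together with \<open>1\<close> they form a copy of \<open>A(\<omega>\<^sub>1)\<close>.
\<close>

section \<open>Convergent families and the one-point compactification\<close>

text \<open>
  Sending the point at infinity to \<open>p\<close> and \<open>i\<close> to \<open>g i\<close> is a continuous bijection: the
  convergence hypothesis is exactly continuity at infinity. As the compactification is compact
  and \<open>Y\<close> is Hausdorff, it is a homeomorphism.
\<close>

lemma Alexandroff_discrete_homeomorphic_convergent_family: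
  fixes g :: "'i \<Rightarrow> 'b"
  assumes "Hausdorff_space Y" "p \<in> topspace Y" "range g \<subseteq> topspace Y"
    and "inj g" "p \<notin> range g"
    and conv: "\<And>U. openin Y U \<Longrightarrow> p \<in> U \<Longrightarrow> finite {i. g i \<notin> U}"
  shows "subtopology Y (insert p (range g)) homeomorphic_space
           Alexandroff_compactification (discrete_topology (UNIV :: 'i set))"
proof -
  let ?A = "Alexandroff_compactification (discrete_topology (UNIV :: 'i set))"
  define \<phi> where "\<phi> = case_option p g"
  have img: "\<phi> ` topspace ?A = insert p (range g)"
    by (simp add: \<phi>_def image_image)
  have "continuous_map ?A Y \<phi>"
    unfolding continuous_map
  proof (intro conjI allI impI)
    show "\<phi> ` topspace ?A \<subseteq> topspace Y"
      unfolding img using assms by blast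
    fix U assume U: "openin Y U"
    show "openin ?A {x \<in> topspace ?A. \<phi> x \<in> U}"
    proof (cases "p \<in> U")
      case True
      have "{x \<in> topspace ?A. \<phi> x \<in> U} = insert None (Some ` (UNIV - {i. g i \<notin> U}))"
      proof (rule Set.set_eqI)
        fix x show "x \<in> {x \<in> topspace ?A. \<phi> x \<in> U} \<longleftrightarrow>
            x \<in> insert None (Some ` (UNIV - {i. g i \<notin> U}))"
          using True by (cases x) (auto simp: \<phi>_def)
      qed
      then show ?thesis
        using conv[OF U True] unfolding openin_Alexandroff_compactification
        by (intro disjI2 exI[of _ "{i. g i \<notin> U}"]) (simp add: compactin_discrete_topology)
    next
      case False
      have "{x \<in> topspace ?A. \<phi> x \<in> U} = Some ` {i. g i \<in> U}"
      proof (rule Set.set_eqI)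
        fix x show "x \<in> {x \<in> topspace ?A. \<phi> x \<in> U} \<longleftrightarrow> x \<in> Some ` {i. g i \<in> U}"
          using False by (cases x) (auto simp: \<phi>_def)
      qed
      then show ?thesis by simp
    qed
  qed
  then have "continuous_map ?A (subtopology Y (insert p (range g))) \<phi>"
    using img unfolding continuous_map_in_subtopology by blast
  moreover have "inj_on \<phi> (topspace ?A)"
    using assms(4,5) by (auto simp: \<phi>_def inj_on_def dest: injD split: option.splits)
  moreover have "\<phi> ` topspace ?A = topspace (subtopology Y (insert p (range g)))"
    unfolding img using assms(2,3) by (simp add: Int_absorb1)
  ultimately have "homeomorphic_map ?A (subtopology Y (insert p (range g))) \<phi>"
    by (intro continuous_imp_homeomorphic_map)
      (auto intro: Hausdorff_space_subtopology assms(1))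
  then show ?thesis
    using homeomorphic_map_imp_homeomorphic_space homeomorphic_space_sym by blast
qed

text \<open>
  In a product, a family which is eventually equal to the limit at each single coordinate
  converges in the sense of the previous lemma, since a basic neighbourhood involves only
  finitely many coordinates.
\<close>

lemma finite_outside_nbhd_product_topology:
  assumes "openin (product_topology T I) U" "p \<in> U"
    and "\<And>i. g i \<in> topspace (product_topology T I)"
    and pf: "\<And>k. k \<in> I \<Longrightarrow> finite {i. g i k \<noteq> p k}"
  shows "finite {i. g i \<notin> U}"
proof -
  obtain V where V: "finite {k \<in> I. V k \<noteq> topspace (T k)}" "p \<in> Pi\<^sub>E I V" "Pi\<^sub>E I V \<subseteq> U"
    using assms(1,2) by (force simp: openin_product_topology_alt)
  have "{i. g i \<notin> U} \<subseteq> (\<Union>k\<in>{k \<in> I. V k \<noteq> topspace (T k)}. {i. g i k \<noteq> p k})"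
  proof
    fix i assume "i \<in> {i. g i \<notin> U}"
    then have "g i \<notin> Pi\<^sub>E I V" using V(3) by auto
    then obtain k where k: "k \<in> I" "g i k \<notin> V k"
      using assms(3)[of i] by (auto simp: PiE_iff)
    moreover have "g i k \<in> topspace (T k)"
      using assms(3)[of i] k(1) by (auto simp: PiE_iff)
    moreover have "p k \<in> V k"
      using V(2) k(1) by auto
    ultimately show "i \<in> (\<Union>k\<in>{k \<in> I. V k \<noteq> topspace (T k)}. {i. g i k \<noteq> p k})"
      by auto
  qed
  then show ?thesis
    by (rule finite_subset) (use V(1) pf in auto)
qed

section \<open>Countably many traces\<close>

text \<open>
  The condition \<open>\<beta> \<ge> \<xi>\<close> makes \<open>f \<alpha> \<beta>\<close> relevant only for \<open>\<alpha> < \<beta>\<close>, which is where the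
  functions \<open>L\<close>, \<open>osc\<close> and \<open>\<lambda>\<alpha> \<beta>. e \<beta> \<alpha>\<close> are meaningful.
\<close>

definition countably_many_traces :: "('a::wellorder \<Rightarrow> 'a \<Rightarrow> 'b) \<Rightarrow> bool" where
  "countably_many_traces f \<longleftrightarrow>
     (\<forall>\<xi>. countable ((\<lambda>\<beta>. restrict (\<lambda>\<alpha>. f \<alpha> \<beta>) {..<\<xi>}) ` {\<xi>..}))"

text \<open>
  All the counting is done with a key \<open>k x\<close> which ranges over a countable set and determines
  \<open>f x\<close>.
\<close>

lemma countable_image_factor:
  assumes "countable (k ` A)"
    and "\<And>x y. x \<in> A \<Longrightarrow> y \<in> A \<Longrightarrow> k x = k y \<Longrightarrow> f x = f y"
  shows "countable (f ` A)"
proof -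
  have "f ` A \<subseteq> (f \<circ> inv_into A k) ` (k ` A)"
  proof
    fix y assume "y \<in> f ` A"
    then obtain x where x: "x \<in> A" "y = f x" by blast
    have "f x = f (inv_into A k (k x))"
      using x by (intro assms(2)) (auto simp: inv_into_into f_inv_into_f)
    then show "y \<in> (f \<circ> inv_into A k) ` (k ` A)" using x by auto
  qed
  then show ?thesis
    by (rule countable_subset) (intro countable_image assms(1))
qed

lemma countable_image_Pair:
  assumes "countable (f ` A)" "countable (g ` A)"
  shows "countable ((\<lambda>x. (f x, g x)) ` A)"
  by (rule countable_subset[OF _ countable_SIGMA[OF assms(1), of "\<lambda>_. g ` A"]])
    (use assms(2) in auto)

lemma countable_finite_subset_valued_image:
  assumes "countable T" "\<And>x. x \<in> A \<Longrightarrow> finite (f x) \<and> f x \<subseteq> T"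
  shows "countable (f ` A)"
  by (rule countable_subset[OF _ countable_Collect_finite_subset[OF assms(1)]])
    (use assms(2) in auto)

lemma countably_many_traces_coherent:
  fixes e :: "'a::wellorder \<Rightarrow> 'a \<Rightarrow> nat"
  assumes "omega1_order TYPE('a)" "coherent_sequence e"
  shows "countably_many_traces (\<lambda>\<alpha> \<beta>. e \<beta> \<alpha>)"
  unfolding countably_many_traces_def
proof
  fix \<xi> :: 'a
  \<comment> \<open>The finite correction that turns \<open>e \<xi>\<close> into \<open>e \<beta>\<close> below \<open>\<xi>\<close> serves as the key.\<close>
  define D where "D \<beta> = (\<lambda>\<alpha>. (\<alpha>, e \<beta> \<alpha>)) ` {\<alpha>. \<alpha> < \<xi> \<and> e \<xi> \<alpha> \<noteq> e \<beta> \<alpha>}" for \<beta>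
  have fin: "finite {\<alpha>. \<alpha> < \<xi> \<and> e \<xi> \<alpha> \<noteq> e \<beta> \<alpha>}" if "\<beta> \<ge> \<xi>" for \<beta>
  proof (cases "\<beta> = \<xi>")
    case False
    with that show ?thesis using assms(2) by (auto simp: coherent_sequence_def)
  qed simp
  show "countable ((\<lambda>\<beta>. restrict (e \<beta>) {..<\<xi>}) ` {\<xi>..})"
  proof (rule countable_image_factor)
    show "countable (D ` {\<xi>..})"
    proof (rule countable_finite_subset_valued_image)
      show "countable ({..<\<xi>} \<times> (UNIV :: nat set))"
        using assms(1) by (intro countable_SIGMA) (auto simp: omega1_order_def)
    qed (use fin in \<open>auto simp: D_def\<close>)
    fix \<beta> \<gamma> assume eq: "D \<beta> = D \<gamma>"
    have "e \<beta> \<alpha> = e \<gamma> \<alpha>" if "\<alpha> < \<xi>" for \<alpha>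
    proof (rule ccontr)
      assume ne: "e \<beta> \<alpha> \<noteq> e \<gamma> \<alpha>"
      then have "(\<alpha>, e \<beta> \<alpha>) \<in> D \<beta> \<or> (\<alpha>, e \<gamma> \<alpha>) \<in> D \<gamma>"
        using that by (cases "e \<xi> \<alpha> = e \<beta> \<alpha>") (auto simp: D_def)
      then have "(\<alpha>, e \<beta> \<alpha>) \<in> D \<gamma> \<or> (\<alpha>, e \<gamma> \<alpha>) \<in> D \<beta>"
        using eq by simp
      then show False using ne by (auto simp: D_def)
    qed
    then show "restrict (e \<beta>) {..<\<xi>} = restrict (e \<gamma>) {..<\<xi>}"
      by (intro restrict_ext) auto
  qed
qed

text \<open>
  Since \<open>Min (L \<alpha> \<xi>)\<close> tends to \<open>\<xi>\<close>, it exceeds all elements of the finite set \<open>s \<subseteq> \<xi>\<close> for all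
  large \<open>\<alpha> < \<xi>\<close>, and then the concatenation property of \<open>L\<close> applies to
  \<open>\<alpha> \<le> \<xi> \<le> \<beta>\<close>. The point is that \<open>\<delta>\<close> depends on \<open>s\<close> but not on \<open>\<beta>\<close>.
\<close>

lemma lower_trace_near_limit:
  fixes L :: "'a::wellorder \<Rightarrow> 'a \<Rightarrow> 'a set"
  assumes L: "lower_trace L" and lim: "limit_ordinal \<xi>" and s: "finite s" "s \<subseteq> {..<\<xi>}"
  shows "\<exists>\<delta><\<xi>. \<forall>\<alpha> \<beta>. \<delta> \<le> \<alpha> \<and> \<alpha> < \<xi> \<and> \<xi> \<le> \<beta> \<and> L \<xi> \<beta> = s \<longrightarrow> L \<alpha> \<beta> = s \<union> L \<alpha> \<xi>"
proof -
  have "\<exists>\<gamma><\<xi>. \<forall>x\<in>s. x \<le> \<gamma>"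
  proof (cases "s = {}")
    case True then show ?thesis using lim by (auto simp: limit_ordinal_def)
  next
    case False then show ?thesis using s by (intro exI[of _ "Max s"]) auto
  qed
  then obtain \<gamma> where \<gamma>: "\<gamma> < \<xi>" "\<forall>x\<in>s. x \<le> \<gamma>" by blast
  obtain \<delta> where \<delta>: "\<delta> < \<xi>" "\<forall>\<alpha>. \<delta> < \<alpha> \<and> \<alpha> < \<xi> \<longrightarrow> \<gamma> < Min (L \<alpha> \<xi>)"
    using L lim \<gamma>(1) unfolding lower_trace_def by meson
  \<comment> \<open>The strict inequality \<open>\<delta> < \<delta>'\<close> also makes every \<open>\<alpha> \<ge> \<delta>'\<close> nonzero, as the concatenation
    property requires.\<close>
  obtain \<delta>' where \<delta>': "\<delta> < \<delta>'" "\<delta>' < \<xi>"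
    using lim \<delta>(1) by (auto simp: limit_ordinal_def)
  show ?thesis
  proof (intro exI[of _ \<delta>'] conjI allI impI)
    fix \<alpha> \<beta> assume as: "\<delta>' \<le> \<alpha> \<and> \<alpha> < \<xi> \<and> \<xi> \<le> \<beta> \<and> L \<xi> \<beta> = s"
    then have "\<gamma> < Min (L \<alpha> \<xi>)" using \<delta>(2) \<delta>'(1) by auto
    moreover have "finite (L \<alpha> \<xi>)"
      using L as unfolding lower_trace_def by (meson less_imp_le)
    ultimately have "\<forall>x\<in>L \<xi> \<beta>. \<forall>\<eta>\<in>L \<alpha> \<xi>. x < \<eta>"
      using \<gamma>(2) as by (meson Min_le le_less_trans less_le_trans)
    moreover have "\<delta> \<in> {..<\<alpha>}" using as \<delta>' by auto
    then have "{..<\<alpha>} \<noteq> {}" by blast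
    ultimately have "L \<alpha> \<beta> = L \<xi> \<beta> \<union> L \<alpha> \<xi>"
      using L as unfolding lower_trace_def by (meson less_imp_le)
    then show "L \<alpha> \<beta> = s \<union> L \<alpha> \<xi>" using as by simp
  qed (use \<delta>' in auto)
qed

text \<open>
  At a limit, the trace on \<open>\<xi>\<close> is determined by \<open>L \<xi> \<beta>\<close> and a trace on a smaller ordinal; at a
  successor of \<open>\<gamma>\<close>, by the trace on \<open>\<gamma>\<close> and the single further value \<open>L \<gamma> \<beta>\<close>.
\<close>

lemma countably_many_traces_lower_trace:
  fixes L :: "'a::wellorder \<Rightarrow> 'a \<Rightarrow> 'a set"
  assumes om: "omega1_order TYPE('a)" and L: "lower_trace L"
  shows "countably_many_traces L"
  unfolding countably_many_traces_def
proof
  fix \<xi> :: 'a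
  let ?t = "\<lambda>\<xi> \<beta>. restrict (\<lambda>\<alpha>. L \<alpha> \<beta>) {..<\<xi>}"
  have cnt: "countable {..<\<alpha>}" for \<alpha> :: 'a
    using om by (simp add: omega1_order_def)
  have fin: "finite (L \<alpha> \<beta>) \<and> L \<alpha> \<beta> \<subseteq> {..<\<alpha>}" if "\<alpha> \<le> \<beta>" for \<alpha> \<beta>
    using L that unfolding lower_trace_def by blast
  show "countable (?t \<xi> ` {\<xi>..})"
  proof (induction \<xi> rule: less_induct)
    case (less \<xi>)
    consider "{..<\<xi>} = {}" | "limit_ordinal \<xi>" | \<gamma> where "\<gamma> < \<xi>" "\<forall>\<delta><\<xi>. \<delta> \<le> \<gamma>"
      unfolding limit_ordinal_def by (meson linorder_not_less)
    then show ?case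
    proof cases
      case 1
      show ?thesis
        by (rule countable_subset[of _ "{?t \<xi> \<xi>}"]) (auto simp: 1)
    next
      case 2
      \<comment> \<open>Once the value \<open>s\<close> of \<open>L \<xi> \<beta>\<close> is fixed, the bound \<open>\<delta>\<close> no longer depends on \<open>\<beta>\<close>, and
        the trace on \<open>\<delta>\<close> determines the trace on \<open>\<xi>\<close>.\<close>
      let ?S = "L \<xi> ` {\<xi>..}"
      have S: "countable ?S"
        using countable_finite_subset_valued_image[OF cnt] fin by (metis atLeast_iff)
      have "countable (?t \<xi> ` {\<beta> \<in> {\<xi>..}. L \<xi> \<beta> = s})" if s: "s \<in> ?S" for s
      proof -
        have "finite s" "s \<subseteq> {..<\<xi>}" using s fin by auto
        then obtain \<delta> where \<delta>: "\<delta> < \<xi>"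
            "\<forall>\<alpha> \<beta>. \<delta> \<le> \<alpha> \<and> \<alpha> < \<xi> \<and> \<xi> \<le> \<beta> \<and> L \<xi> \<beta> = s \<longrightarrow> L \<alpha> \<beta> = s \<union> L \<alpha> \<xi>"
          using lower_trace_near_limit[OF L 2] by meson
        show ?thesis
        proof (rule countable_image_factor)
          show "countable (?t \<delta> ` {\<beta> \<in> {\<xi>..}. L \<xi> \<beta> = s})"
            by (rule countable_subset[OF image_mono less[OF \<delta>(1)]]) (use \<delta>(1) in auto)
          fix \<beta> \<gamma> assume as: "\<beta> \<in> {\<beta> \<in> {\<xi>..}. L \<xi> \<beta> = s}" "\<gamma> \<in> {\<beta> \<in> {\<xi>..}. L \<xi> \<beta> = s}"
            and eq: "?t \<delta> \<beta> = ?t \<delta> \<gamma>"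
          show "?t \<xi> \<beta> = ?t \<xi> \<gamma>"
          proof (rule restrict_ext)
            fix \<alpha> assume "\<alpha> \<in> {..<\<xi>}"
            show "L \<alpha> \<beta> = L \<alpha> \<gamma>"
            proof (cases "\<alpha> < \<delta>")
              case True
              then show ?thesis using fun_cong[OF eq, of \<alpha>] by simp
            next
              case False
              then have "L \<alpha> \<beta> = s \<union> L \<alpha> \<xi>" "L \<alpha> \<gamma> = s \<union> L \<alpha> \<xi>"
                using \<delta>(2) as \<open>\<alpha> \<in> {..<\<xi>}\<close> by auto
              then show ?thesis by simp
            qed
          qed
        qed
      qed
      then have "countable (\<Union>s\<in>?S. ?t \<xi> ` {\<beta> \<in> {\<xi>..}. L \<xi> \<beta> = s})"
        using S by blast
      then show ?thesis
        by (rule countable_subset[rotated]) blast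
    next
      case 3
      show ?thesis
      proof (rule countable_image_factor)
        have "countable (?t \<gamma> ` {\<xi>..})"
          by (rule countable_subset[OF image_mono less[OF 3(1)]]) (use 3 in auto)
        moreover have "countable (L \<gamma> ` {\<xi>..})"
          by (rule countable_finite_subset_valued_image[OF cnt[of \<gamma>]]) (use 3 fin in auto)
        ultimately show "countable ((\<lambda>\<beta>. (?t \<gamma> \<beta>, L \<gamma> \<beta>)) ` {\<xi>..})"
          by (rule countable_image_Pair)
        fix \<beta> \<beta>' assume "(?t \<gamma> \<beta>, L \<gamma> \<beta>) = (?t \<gamma> \<beta>', L \<gamma> \<beta>')"
        then have eq: "?t \<gamma> \<beta> = ?t \<gamma> \<beta>'" "L \<gamma> \<beta> = L \<gamma> \<beta>'"
          unfolding prod.inject by blast+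
        show "?t \<xi> \<beta> = ?t \<xi> \<beta>'"
        proof (rule restrict_ext)
          fix \<alpha> assume "\<alpha> \<in> {..<\<xi>}"
          then have "\<alpha> < \<gamma> \<or> \<alpha> = \<gamma>" using 3(2) by auto
          moreover have "L \<alpha> \<beta> = L \<alpha> \<beta>'" if "\<alpha> < \<gamma>"
            using fun_cong[OF eq(1), of \<alpha>] that by simp
          ultimately show "L \<alpha> \<beta> = L \<alpha> \<beta>'" using eq(2) by blast
        qed
      qed
    qed
  qed
qed

text \<open>
  The set \<open>L \<alpha> \<beta>\<close> lies below \<open>\<alpha>\<close>, so the definition of \<open>osc\<close> evaluates \<open>e \<beta>\<close> only below
  \<open>\<alpha>\<close>. This includes the predecessor of a point \<open>x\<close> in \<open>L \<alpha> \<beta>\<close>: it is the maximum of a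
  set which is nonempty because \<open>x\<close> is not the minimum of \<open>L \<alpha> \<beta>\<close>.
\<close>

lemma osc_cong:
  assumes L: "lower_trace L" and "\<alpha> \<le> \<beta>" and "L \<alpha> \<beta> = L \<alpha> \<gamma>"
    and e: "\<And>x. x < \<alpha> \<Longrightarrow> e \<beta> x = e \<gamma> x"
  shows "osc e L \<alpha> \<beta> = osc e L \<alpha> \<gamma>"
proof -
  have fin: "finite (L \<alpha> \<beta>)" "L \<alpha> \<beta> \<subseteq> {..<\<alpha>}"
    using L assms(2) unfolding lower_trace_def by blast+
  have "(let p = Max {\<eta> \<in> L \<alpha> \<beta>. \<eta> < x} in e \<alpha> p = e \<beta> p \<and> e \<alpha> x > e \<beta> x) =
        (let p = Max {\<eta> \<in> L \<alpha> \<beta>. \<eta> < x} in e \<alpha> p = e \<gamma> p \<and> e \<alpha> x > e \<gamma> x)"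
    if x: "x \<in> L \<alpha> \<beta> - {Min (L \<alpha> \<beta>)}" for x
  proof -
    have "Min (L \<alpha> \<beta>) \<in> {\<eta> \<in> L \<alpha> \<beta>. \<eta> < x}"
      using x fin by (auto simp: less_le intro: Min_in)
    then have "Max {\<eta> \<in> L \<alpha> \<beta>. \<eta> < x} \<in> {\<eta> \<in> L \<alpha> \<beta>. \<eta> < x}"
      using fin by (intro Max_in) auto
    then have "Max {\<eta> \<in> L \<alpha> \<beta>. \<eta> < x} < \<alpha>" "x < \<alpha>" using fin x by auto
    then show ?thesis using e by (simp add: Let_def)
  qed
  then have "{x \<in> L \<alpha> \<beta> - {Min (L \<alpha> \<beta>)}.
      let p = Max {\<eta> \<in> L \<alpha> \<beta>. \<eta> < x} in e \<alpha> p = e \<beta> p \<and> e \<alpha> x > e \<beta> x} =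
    {x \<in> L \<alpha> \<beta> - {Min (L \<alpha> \<beta>)}.
      let p = Max {\<eta> \<in> L \<alpha> \<beta>. \<eta> < x} in e \<alpha> p = e \<gamma> p \<and> e \<alpha> x > e \<gamma> x}"
    by blast
  then show ?thesis
    unfolding osc_def assms(3) by simp
qed

lemma countably_many_traces_osc:
  fixes e :: "'a::wellorder \<Rightarrow> 'a \<Rightarrow> nat"
  assumes "omega1_order TYPE('a)" "coherent_sequence e" "lower_trace L"
  shows "countably_many_traces (osc e L)"
  unfolding countably_many_traces_def
proof
  fix \<xi> :: 'a
  let ?k = "\<lambda>\<beta>. (restrict (\<lambda>\<alpha>. L \<alpha> \<beta>) {..<\<xi>}, restrict (e \<beta>) {..<\<xi>})"
  show "countable ((\<lambda>\<beta>. restrict (\<lambda>\<alpha>. osc e L \<alpha> \<beta>) {..<\<xi>}) ` {\<xi>..})"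
  proof (rule countable_image_factor)
    show "countable (?k ` {\<xi>..})"
      using countably_many_traces_lower_trace[OF assms(1,3)]
        countably_many_traces_coherent[OF assms(1,2)]
      unfolding countably_many_traces_def by (intro countable_image_Pair) auto
    fix \<beta> \<gamma> assume as: "\<beta> \<in> {\<xi>..}" "?k \<beta> = ?k \<gamma>"
    then have eq: "restrict (\<lambda>\<alpha>. L \<alpha> \<beta>) {..<\<xi>} = restrict (\<lambda>\<alpha>. L \<alpha> \<gamma>) {..<\<xi>}"
        "restrict (e \<beta>) {..<\<xi>} = restrict (e \<gamma>) {..<\<xi>}"
      unfolding prod.inject by blast+
    have "L x \<beta> = L x \<gamma>" "e \<beta> x = e \<gamma> x" if "x < \<xi>" for x
      using fun_cong[OF eq(1), of x] fun_cong[OF eq(2), of x] that by simp_all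
    then show "restrict (\<lambda>\<alpha>. osc e L \<alpha> \<beta>) {..<\<xi>} = restrict (\<lambda>\<alpha>. osc e L \<alpha> \<gamma>) {..<\<xi>}"
      using as(1) by (intro restrict_ext osc_cong[OF assms(3)]) auto
  qed
qed

section \<open>Pairs with equal traces\<close>

lemma countable_bounded:
  fixes C :: "'a::wellorder set"
  assumes "omega1_order TYPE('a)" "countable C"
  shows "\<exists>\<xi>. \<forall>c\<in>C. c \<le> \<xi>"
proof -
  have "countable (\<Union>c\<in>C. {..<c})"
    using assms by (intro countable_UN) (simp_all add: omega1_order_def)
  moreover have "uncountable (UNIV :: 'a set)"
    using assms(1) by (simp add: omega1_order_def)
  ultimately have "(\<Union>c\<in>C. {..<c}) \<noteq> UNIV" by metis
  then obtain \<xi> where "\<xi> \<notin> (\<Union>c\<in>C. {..<c})" by blast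
  then have "\<forall>c\<in>C. c \<le> \<xi>" by (auto simp: not_less)
  then show ?thesis ..
qed

text \<open>
  Pigeonhole: uncountably many elements of \<open>X\<close> lie above \<open>\<xi>\<close>, but they have only countably
  many traces on \<open>\<xi>\<close>.
\<close>

lemma pair_with_equal_traces:
  fixes f :: "'a::wellorder \<Rightarrow> 'a \<Rightarrow> 'b"
  assumes "omega1_order TYPE('a)" "countably_many_traces f" "uncountable X"
  shows "\<exists>\<beta>\<in>X. \<exists>\<gamma>\<in>X. \<xi> \<le> \<beta> \<and> \<beta> < \<gamma> \<and> (\<forall>\<alpha><\<xi>. f \<alpha> \<beta> = f \<alpha> \<gamma>)"
proof -
  let ?t = "\<lambda>\<beta>. restrict (\<lambda>\<alpha>. f \<alpha> \<beta>) {..<\<xi>}"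
  let ?Y = "X - {..<\<xi>}"
  have "uncountable ?Y"
    using assms by (intro uncountable_minus_countable) (auto simp: omega1_order_def)
  moreover have "countable (?t ` ?Y)"
  proof (rule countable_subset)
    show "?t ` ?Y \<subseteq> ?t ` {\<xi>..}" by auto
    show "countable (?t ` {\<xi>..})"
      using assms(2) by (simp add: countably_many_traces_def)
  qed
  ultimately have "\<not> inj_on ?t ?Y"
    using countable_image_inj_on by blast
  then obtain \<beta> \<gamma> where bc: "\<beta> \<in> ?Y" "\<gamma> \<in> ?Y" "?t \<beta> = ?t \<gamma>" "\<beta> \<noteq> \<gamma>"
    unfolding inj_on_def by blast
  have "f \<alpha> \<beta> = f \<alpha> \<gamma>" if "\<alpha> < \<xi>" for \<alpha>
    using fun_cong[OF bc(3), of \<alpha>] that by simp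
  moreover have "\<beta> < \<gamma> \<or> \<gamma> < \<beta>" using bc(4) by auto
  ultimately show ?thesis using bc(1,2) by (metis Diff_iff lessThan_iff not_less)
qed

text \<open>
  Transfinite recursion: countably many pairs have been chosen before stage \<open>j\<close>, so some \<open>\<xi>\<close>
  bounds them all, and the next pair is taken above \<open>\<xi>\<close> with equal traces on \<open>\<xi>\<close>.
\<close>

lemma separated_pairs_with_equal_traces:
  fixes f :: "'a::wellorder \<Rightarrow> 'a \<Rightarrow> 'b"
  assumes "omega1_order TYPE('a)" "countably_many_traces f" "uncountable X"
  obtains b c :: "'a \<Rightarrow> 'a"
  where "\<And>i. b i \<in> X" "\<And>i. c i \<in> X" "\<And>i. b i < c i"
    and "\<And>i j. i < j \<Longrightarrow> c i \<le> b j"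
    and "\<And>i j \<alpha>. i < j \<Longrightarrow> \<alpha> < c i \<Longrightarrow> f \<alpha> (b j) = f \<alpha> (c j)"
proof -
  define P where "P h i r \<longleftrightarrow> fst r \<in> X \<and> snd r \<in> X \<and> fst r < snd r \<and>
    (\<forall>j<i. snd (h j) \<le> fst r \<and> (\<forall>\<alpha><snd (h j). f \<alpha> (fst r) = f \<alpha> (snd r)))"
    for h :: "'a \<Rightarrow> 'a \<times> 'a" and i r
  have "\<exists>h. \<forall>i. P h i (h i)"
  proof (rule dependent_wellorder_choice)
    fix r and h h' :: "'a \<Rightarrow> 'a \<times> 'a" and i
    assume "\<And>j. j < i \<Longrightarrow> h j = h' j"
    then show "P h i r = P h' i r" by (auto simp: P_def)
  next
    fix i and h :: "'a \<Rightarrow> 'a \<times> 'a"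
    have "countable ((snd \<circ> h) ` {..<i})"
      using assms(1) by (auto simp: omega1_order_def)
    then obtain \<xi> where \<xi>: "\<forall>x \<in> (snd \<circ> h) ` {..<i}. x \<le> \<xi>"
      using countable_bounded[OF assms(1)] by blast
    obtain \<beta> \<gamma> where "\<beta> \<in> X" "\<gamma> \<in> X" "\<xi> \<le> \<beta>" "\<beta> < \<gamma>" "\<forall>\<alpha><\<xi>. f \<alpha> \<beta> = f \<alpha> \<gamma>"
      using pair_with_equal_traces[OF assms] by blast
    moreover have "snd (h j) \<le> \<xi>" if "j < i" for j
      using \<xi> that by auto
    ultimately have "P h i (\<beta>, \<gamma>)"
      unfolding P_def by (metis fst_conv snd_conv order_trans less_le_trans)
    then show "\<exists>r. P h i r" ..
  qed
  then obtain h where h: "\<And>i. P h i (h i)" by blast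
  show thesis
    by (rule that[of "fst \<circ> h" "snd \<circ> h"]) (use h in \<open>auto simp: P_def\<close>)
qed

section \<open>The convergent family of quotients\<close>

lemma inv_circle_group:
  assumes "x \<in> carrier circle_group"
  shows "inv\<^bsub>circle_group\<^esub> x = inverse x"
  using assms by (intro group.inv_equality[OF group_circle_group])
    (auto simp: circle_group_def norm_inverse intro!: left_inverse)

lemma rationally_independent_power_neq_1:
  assumes "rationally_independent z" "n > 0"
  shows "z \<alpha> ^ n \<noteq> 1"
proof
  assume "z \<alpha> ^ n = 1"
  then have "(\<Prod>\<alpha>\<in>{\<alpha>}. z \<alpha> powi int n) = 1" by simp
  then have "\<forall>\<alpha>\<in>{\<alpha>}. int n = 0"
    using assms(1) unfolding rationally_independent_def
    by (elim allE[of _ "{\<alpha>}"] allE[of _ "\<lambda>_. int n"]) auto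
  then show False using assms(2) by simp
qed

theorem proposition2p9:
  fixes e :: "'a::wellorder \<Rightarrow> 'a \<Rightarrow> nat"
    and L :: "'a \<Rightarrow> 'a \<Rightarrow> 'a set"
    and z :: "'a \<Rightarrow> complex"
    and X :: "'a set"
  assumes "omega1_order TYPE('a)"
    and "coherent_sequence e"
    and "lower_trace L"
    and "moore_property (osc e L)"
    and "\<And>\<alpha>. z \<alpha> \<in> sphere 0 1"
    and "rationally_independent z"
    and "uncountable X"
  shows "\<exists>K \<subseteq> generate (torus_group X) (L_space (osc e L) z X).
           subtopology (torus_topology X) K homeomorphic_space
             Alexandroff_compactification (discrete_topology (UNIV :: 'a set))"
proof -
  let ?w = "w_point (osc e L) z"
  let ?G = "torus_group X"
  obtain b c :: "'a \<Rightarrow> 'a" where bc: "\<And>i. b i \<in> X" "\<And>i. c i \<in> X" "\<And>i. b i < c i"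
    and sep: "\<And>i j. i < j \<Longrightarrow> c i \<le> b j"
    and eq: "\<And>i j \<alpha>. i < j \<Longrightarrow> \<alpha> < c i \<Longrightarrow> osc e L \<alpha> (b j) = osc e L \<alpha> (c j)"
    using separated_pairs_with_equal_traces[OF assms(1)
        countably_many_traces_osc[OF assms(1-3)] assms(7)] by metis
  define g where "g i = (\<lambda>\<alpha>\<in>X. ?w (b i) \<alpha> * inverse (?w (c i) \<alpha>))" for i
  have norm_w: "norm (?w \<beta> \<alpha>) = 1" for \<alpha> \<beta>
    using assms(5)[of \<alpha>] by (simp add: w_point_def norm_power norm_mult)
  have w_nz: "?w \<beta> \<alpha> \<noteq> 0" for \<alpha> \<beta>
    using norm_w[of \<beta> \<alpha>] by auto
  have above: "g i \<alpha> = 1" if "\<alpha> \<in> X" "c i \<le> \<alpha>" for i \<alpha>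
    using that bc(3)[of i] by (auto simp: g_def w_point_def)
  have below: "g j \<alpha> = 1" if "\<alpha> \<in> X" "i < j" "\<alpha> < c i" for i j \<alpha>
  proof -
    have "\<alpha> < b j" "\<alpha> < c j"
      using that sep[OF that(2)] bc(3)[of j] by auto
    then have "?w (b j) \<alpha> = ?w (c j) \<alpha>"
      using eq[OF that(2,3)] by (simp add: w_point_def)
    then show ?thesis using that(1) w_nz by (simp add: g_def)
  qed
  \<comment> \<open>For \<open>i < j\<close>, a coordinate \<open>\<alpha>\<close> lies either above the support of \<open>g i\<close> or below that of
    \<open>g j\<close>, according to whether \<open>c i \<le> \<alpha>\<close> or \<open>\<alpha> < c i\<close>.\<close>
  have disj: "i = j" if "\<alpha> \<in> X" "g i \<alpha> \<noteq> 1" "g j \<alpha> \<noteq> 1" for i j \<alpha>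
    using that above below by (metis linorder_cases not_less)
  have nontriv: "g i (b i) \<noteq> 1" for i
    using bc[of i] rationally_independent_power_neq_1[OF assms(6)]
    by (simp add: g_def w_point_def del: power_Suc)
  have one: "\<one>\<^bsub>?G\<^esub> = (\<lambda>\<alpha>\<in>X. 1)"
    by (simp add: torus_group_def circle_group_def)
  have g_gen: "g i \<in> generate ?G (L_space (osc e L) z X)" for i
  proof -
    have car: "restrict (?w \<beta>) X \<in> (\<Pi>\<^sub>E i\<in>X. carrier circle_group)" for \<beta>
      by (auto simp: circle_group_def norm_w)
    have inv_w: "inv\<^bsub>circle_group\<^esub> ?w \<beta> \<alpha> = inverse (?w \<beta> \<alpha>)" for \<alpha> \<beta>
      by (rule inv_circle_group) (simp add: circle_group_def norm_w)
    have mult_circle: "x \<otimes>\<^bsub>circle_group\<^esub> y = x * y" for x y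
      by (simp add: circle_group_def)
    have "g i = restrict (?w (b i)) X \<otimes>\<^bsub>?G\<^esub> inv\<^bsub>?G\<^esub> restrict (?w (c i)) X"
      unfolding torus_group_def inv_product_group[OF car group_circle_group]
      by (auto simp: g_def inv_w mult_circle fun_eq_iff)
    also have "\<dots> \<in> generate ?G (L_space (osc e L) z X)"
      using bc(1,2) by (intro generate.eng generate.incl generate.inv) (auto simp: L_space_def)
    finally show ?thesis .
  qed
  have g_top: "g i \<in> topspace (torus_topology X)" for i
    by (auto simp: torus_topology_def g_def norm_mult norm_inverse norm_w)
  show ?thesis
  proof (intro exI[of _ "insert \<one>\<^bsub>?G\<^esub> (range g)"] conjI)
    show "insert \<one>\<^bsub>?G\<^esub> (range g) \<subseteq> generate ?G (L_space (osc e L) z X)"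
      using g_gen generate.one by auto
    show "subtopology (torus_topology X) (insert \<one>\<^bsub>?G\<^esub> (range g)) homeomorphic_space
        Alexandroff_compactification (discrete_topology (UNIV :: 'a set))"
    proof (rule Alexandroff_discrete_homeomorphic_convergent_family)
      show "Hausdorff_space (torus_topology X)"
        unfolding torus_topology_def Hausdorff_space_product_topology
        by (simp add: Hausdorff_space_subtopology)
      show "\<one>\<^bsub>?G\<^esub> \<in> topspace (torus_topology X)"
        by (auto simp: one torus_topology_def)
      show "range g \<subseteq> topspace (torus_topology X)"
        using g_top by blast
      show "inj g"
        by (rule injI) (metis bc(1) disj nontriv)
      show "\<one>\<^bsub>?G\<^esub> \<notin> range g"
        using nontriv bc(1) unfolding one by (metis imageE restrict_apply')
      fix U assume "openin (torus_topology X) U" "\<one>\<^bsub>?G\<^esub> \<in> U"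
      then show "finite {i. g i \<notin> U}"
        unfolding torus_topology_def
      proof (rule finite_outside_nbhd_product_topology)
        fix k assume k: "k \<in> X"
        have "{i. g i k \<noteq> 1} \<subseteq> {i}" if "g i k \<noteq> 1" for i
          using disj[OF k _ that] by auto
        then have "finite {i. g i k \<noteq> 1}"
          by (metis (mono_tags, lifting) Collect_empty_eq finite.emptyI finite_insert finite_subset)
        then show "finite {i. g i k \<noteq> \<one>\<^bsub>?G\<^esub> k}"
          using k by (simp add: one)
      qed (use g_top in \<open>simp add: torus_topology_def\<close>)
    qed
  qed
qed

end
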